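(* Let $t\in\mathbb{Z}^+$ and let $\mathrm{Alg}$ be a deterministic $(\alpha,\beta,\gamma)$-competitive algorithm for $\mathrm{ASG}_t$ with respect to $(\mu_0,\mu_1)$. Then $\mathrm{Alg}$ is Pareto-optimal with respect to $(\mu_0,\mu_1)$ if and only if (i) $\alpha=t$ and $\beta=\gamma=0$, or (ii) $\alpha<t$, $\beta=t-\alpha$, and $\gamma=1$.
   Context: Online $(1,t)$-Asymmetric String Guessing with Unknown History and Predictions ($\mathrm{ASG}_t$), $t\in\mathbb{Z}^+$: an instance is a triple $I=(x,\hat{x},r)$ where $x,\hat x\in\{0,1\}^n$ and $r=\langle r_1,\dots,r_n\rangle$. Each request $r_i$ is a prompt to irrevocably output a bit $y_i$; together with $r_i$ the prediction bit $\hat{x}_i$ is revealed; $x$ is revealed only after the last request. Cost: $\mathrm{Alg}(I)=\sum_{i=1}^n\big(y_i+t\,x_i(1-y_i)\big)$, and $\mathrm{Opt}(I)=\sum_i x_i$. Error measures: $\mu_0(I)=\sum_{i} x_i(1-\hat{x}_i)$, $\mu_1(I)=\sum_{i} (1-x_i)\hat{x}_i$. An algorithm is $(\alpha,\beta,\gamma)$-competitive with respect to $(\mu_0,\mu_1)$ if there is a constant $\kappa$ such that for all instances $I$, $\mathrm{Alg}(I)\le \alpha\,\mathrm{Opt}(I)+\beta\,\mu_0(I)+\gamma\,\mu_1(I)+\kappa$, with $\alpha,\beta,\gamma\ge0$. An $(\alpha,\beta,\gamma)$-competitive algorithm is Pareto-optimal for a problem if for no $\varepsilon>0$ does there exist an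 $(\alpha-\varepsilon,\beta,\gamma)$-, an $(\alpha,\beta-\varepsilon,\gamma)$-, or an $(\alpha,\beta,\gamma-\varepsilon)$-competitive (deterministic) algorithm for the problem. *)

theory Defs
  imports Complex_Main
begin

text \<open>Bits are booleans. A request carries no information beyond being a prompt.\<close>

datatype request = Prompt

type_synonym asg_instance = "bool list \<times> bool list \<times> request list"

definition asg_instances :: "asg_instance set" where
  "asg_instances = {(x, xh, r). length xh = length x \<and> length r = length x}"

text \<open>A deterministic online algorithm maps what has been revealed so far, namely the requests
  and prediction bits up to and including the current one, to the current output bit. Its own
  earlier outputs are functions of that history. The length of the instance and the string
  \<open>x\<close> are not available to it.\<close>

type_synonym asg_algorithm = "(request \<times> bool) list \<Rightarrow> bool"

definition asg_output :: "asg_algorithm \<Rightarrow> bool list \<Rightarrow> request list \<Rightarrow> nat \<Rightarrow> bool" where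
  "asg_output A xh r i = A (take (Suc i) (zip r xh))"

fun asg_cost :: "nat \<Rightarrow> asg_algorithm \<Rightarrow> asg_instance \<Rightarrow> real" where
  "asg_cost t A (x, xh, r) =
    (\<Sum>i<length x. of_bool (asg_output A xh r i)
       + real t * of_bool (x ! i) * (1 - of_bool (asg_output A xh r i)))"

fun asg_opt :: "asg_instance \<Rightarrow> real" where
  "asg_opt (x, xh, r) = (\<Sum>i<length x. of_bool (x ! i))"

fun mu0 :: "asg_instance \<Rightarrow> real" where
  "mu0 (x, xh, r) = (\<Sum>i<length x. of_bool (x ! i) * (1 - of_bool (xh ! i)))"

fun mu1 :: "asg_instance \<Rightarrow> real" where
  "mu1 (x, xh, r) = (\<Sum>i<length x. (1 - of_bool (x ! i)) * of_bool (xh ! i))"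

definition asg_competitive ::
  "nat \<Rightarrow> (asg_instance \<Rightarrow> real) \<Rightarrow> (asg_instance \<Rightarrow> real) \<Rightarrow>
    real \<Rightarrow> real \<Rightarrow> real \<Rightarrow> asg_algorithm \<Rightarrow> bool" where
  "asg_competitive t \<mu> \<nu> \<alpha> \<beta> \<gamma> A \<longleftrightarrow>
    \<alpha> \<ge> 0 \<and> \<beta> \<ge> 0 \<and> \<gamma> \<ge> 0 \<and>
    (\<exists>\<kappa>::real. \<forall>I\<in>asg_instances.
      asg_cost t A I \<le> \<alpha> * asg_opt I + \<beta> * \<mu> I + \<gamma> * \<nu> I + \<kappa>)"

definition asg_pareto_optimal ::
  "nat \<Rightarrow> (asg_instance \<Rightarrow> real) \<Rightarrow> (asg_instance \<Rightarrow> real) \<Rightarrow>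
    real \<Rightarrow> real \<Rightarrow> real \<Rightarrow> asg_algorithm \<Rightarrow> bool" where
  "asg_pareto_optimal t \<mu> \<nu> \<alpha> \<beta> \<gamma> A \<longleftrightarrow>
    asg_competitive t \<mu> \<nu> \<alpha> \<beta> \<gamma> A \<and>
    (\<forall>\<epsilon>>0. \<not> (\<exists>B. asg_competitive t \<mu> \<nu> (\<alpha> - \<epsilon>) \<beta> \<gamma> B) \<and>
            \<not> (\<exists>B. asg_competitive t \<mu> \<nu> \<alpha> (\<beta> - \<epsilon>) \<gamma> B) \<and>
            \<not> (\<exists>B. asg_competitive t \<mu> \<nu> \<alpha> \<beta> (\<gamma> - \<epsilon>) B))"

end

theory Submission
  imports Defs
begin

text \<open>The triple \<open>(\<alpha>, \<beta>, \<gamma>)\<close> is attainable exactly if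
  \<open>\<alpha> \<ge> 1\<close>, \<open>\<beta>, \<gamma> \<ge> 0\<close>, \<open>\<alpha> + \<beta> \<ge> t\<close>, and \<open>\<alpha> \<ge> t\<close> or \<open>\<gamma> \<ge> 1\<close>; the Pareto-optimal points
  are then read off from this region. Attainability is witnessed by the algorithm that always
  answers 0 (if \<open>\<alpha> \<ge> t\<close>) and by the one that follows the predictions (if \<open>\<gamma> \<ge> 1\<close>).
  For necessity consider constant predictions. If all of them are 0, the algorithm may answer 1 only
  boundedly often because \<open>x\<close> may be all 0, so making \<open>x\<close> all 1 forces \<open>\<alpha> + \<beta> \<ge> t\<close>. If all
  of them are 1, making \<open>x\<close> all 1 forces \<open>\<alpha> \<ge> 1\<close>, and taking for \<open>x\<close> the complement of the
  answers charges \<open>t - \<alpha>\<close> or \<open>1 - \<gamma>\<close> in every round.\<close>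

text \<open>Eliminates the additive constant: a loss of \<open>c\<close> per round that stays
  bounded for all lengths cannot be positive.\<close>

lemma linear_bounded_imp_nonpos:
  fixes c \<kappa> :: real
  assumes "\<And>n::nat. c * real n \<le> \<kappa>"
  shows "c \<le> 0"
proof (rule ccontr)
  assume "\<not> c \<le> 0"
  then obtain n :: nat where "\<kappa> < real n * c"
    using reals_Archimedean3[of c] by auto
  then show False
    using assms[of n] by (simp add: mult.commute)
qed

lemma asg_bound_eq_sum:
  "\<alpha> * asg_opt (x, xh, r) + \<beta> * mu0 (x, xh, r) + \<gamma> * mu1 (x, xh, r) =
    (\<Sum>i<length x. \<alpha> * of_bool (x ! i) + \<beta> * (of_bool (x ! i) * (1 - of_bool (xh ! i)))
      + \<gamma> * ((1 - of_bool (x ! i)) * of_bool (xh ! i)))"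
  by (simp only: asg_opt.simps mu0.simps mu1.simps sum.distrib sum_distrib_left)

text \<open>With constant predictions the history in round \<open>i\<close> depends on neither
  \<open>x\<close> nor the length, so the answers form one fixed sequence \<open>y\<close>. Hence
  \<open>f\<close> may be chosen after \<open>y\<close>, even in terms of it.\<close>

lemma asg_competitive_const_prediction:
  fixes b :: bool
  assumes "asg_competitive t mu0 mu1 \<alpha> \<beta> \<gamma> A"
  obtains \<kappa> and y :: "nat \<Rightarrow> bool" where "\<forall>n f.
    (\<Sum>i<n. of_bool (y i) + real t * of_bool (f i) * (1 - of_bool (y i)))
      \<le> (\<Sum>i<n. \<alpha> * of_bool (f i) + \<beta> * (of_bool (f i) * (1 - of_bool b))
              + \<gamma> * ((1 - of_bool (f i)) * of_bool b)) + \<kappa>"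
proof -
  obtain \<kappa> where \<kappa>: "\<And>I. I \<in> asg_instances \<Longrightarrow>
      asg_cost t A I \<le> \<alpha> * asg_opt I + \<beta> * mu0 I + \<gamma> * mu1 I + \<kappa>"
    using assms unfolding asg_competitive_def by blast
  define y where "y i = A (replicate (Suc i) (Prompt, b))" for i
  show thesis
  proof (rule that[where y = y and \<kappa> = \<kappa>], intro allI)
    fix n and f :: "nat \<Rightarrow> bool"
    let ?I = "(map f [0..<n], replicate n b, replicate n Prompt)"
    have "?I \<in> asg_instances"
      by (simp add: asg_instances_def)
    moreover have "asg_cost t A ?I
        = (\<Sum>i<n. of_bool (y i) + real t * of_bool (f i) * (1 - of_bool (y i)))"
      unfolding asg_cost.simps
      by (intro sum.cong) (auto simp: asg_output_def y_def min_def Suc_le_eq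
          simp del: replicate_Suc)
    moreover have "\<alpha> * asg_opt ?I + \<beta> * mu0 ?I + \<gamma> * mu1 ?I
        = (\<Sum>i<n. \<alpha> * of_bool (f i) + \<beta> * (of_bool (f i) * (1 - of_bool b))
              + \<gamma> * ((1 - of_bool (f i)) * of_bool b))"
      unfolding asg_bound_eq_sum by (intro sum.cong) auto
    ultimately show "(\<Sum>i<n. of_bool (y i) + real t * of_bool (f i) * (1 - of_bool (y i)))
      \<le> (\<Sum>i<n. \<alpha> * of_bool (f i) + \<beta> * (of_bool (f i) * (1 - of_bool b))
              + \<gamma> * ((1 - of_bool (f i)) * of_bool b)) + \<kappa>"
      using \<kappa>[of ?I] by (simp only:)
  qed
qed

lemma asg_competitive_sum_ge:
  assumes "asg_competitive t mu0 mu1 \<alpha> \<beta> \<gamma> A"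
  shows "real t \<le> \<alpha> + \<beta>"
proof -
  obtain \<kappa> and y :: "nat \<Rightarrow> bool" where *: "\<forall>n f.
    (\<Sum>i<n. of_bool (y i) + real t * of_bool (f i) * (1 - of_bool (y i)))
      \<le> (\<Sum>i<n. \<alpha> * of_bool (f i) + \<beta> * (of_bool (f i) * (1 - of_bool False))
              + \<gamma> * ((1 - of_bool (f i)) * of_bool False)) + \<kappa>"
    by (rule asg_competitive_const_prediction[OF assms, where b = False], erule that)
  \<comment> \<open>With \<open>?k\<close> answers equal to 1, the all-1 string costs at least
    \<open>t * (n - ?k)\<close>; since \<open>?k\<close> is at most \<open>\<kappa>\<close>, at most
    \<open>t * \<kappa>\<close> of \<open>t * n\<close> is lost.\<close>
  have "(real t - (\<alpha> + \<beta>)) * real n \<le> \<kappa> + real t * \<kappa>" for n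
  proof -
    let ?k = "\<Sum>i<n. of_bool (y i) :: real"
    have "?k \<le> \<kappa>"
      using *[rule_format, of "\<lambda>_. False" n] by simp
    then have "real t * ?k \<le> real t * \<kappa>"
      by (intro mult_left_mono) auto
    moreover have "?k + real t * (real n - ?k) \<le> (\<alpha> + \<beta>) * real n + \<kappa>"
      using *[rule_format, of "\<lambda>_. True" n]
      by (simp add: sum.distrib sum_subtractf flip: sum_distrib_left) (simp add: algebra_simps)
    moreover have "0 \<le> ?k"
      by (intro sum_nonneg) auto
    ultimately show ?thesis
      by (simp add: algebra_simps)
  qed
  then show ?thesis
    using linear_bounded_imp_nonpos by fastforce
qed

lemma asg_competitive_opt_coeff_ge_1:
  assumes "t > 0" "asg_competitive t mu0 mu1 \<alpha> \<beta> \<gamma> A"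
  shows "1 \<le> \<alpha>"
proof -
  obtain \<kappa> and y :: "nat \<Rightarrow> bool" where *: "\<forall>n f.
    (\<Sum>i<n. of_bool (y i) + real t * of_bool (f i) * (1 - of_bool (y i)))
      \<le> (\<Sum>i<n. \<alpha> * of_bool (f i) + \<beta> * (of_bool (f i) * (1 - of_bool True))
              + \<gamma> * ((1 - of_bool (f i)) * of_bool True)) + \<kappa>"
    by (rule asg_competitive_const_prediction[OF assms(2), where b = True], erule that)
  have "(1 - \<alpha>) * real n \<le> \<kappa>" for n
  proof -
    \<comment> \<open>A round with true bit 1 costs 1 or \<open>t\<close>, and \<open>t\<close> is
      at least 1.\<close>
    have "(\<Sum>i<n. 1) \<le> (\<Sum>i<n. of_bool (y i) + real t * of_bool True * (1 - of_bool (y i)))"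
      using assms(1) by (intro sum_mono) auto
    then show ?thesis
      using *[rule_format, of "\<lambda>_. True" n] by (simp add: algebra_simps)
  qed
  then show ?thesis
    using linear_bounded_imp_nonpos by fastforce
qed

lemma asg_competitive_opt_coeff_ge_or_mu1_coeff_ge:
  assumes "asg_competitive t mu0 mu1 \<alpha> \<beta> \<gamma> A"
  shows "real t \<le> \<alpha> \<or> 1 \<le> \<gamma>"
proof -
  obtain \<kappa> and y :: "nat \<Rightarrow> bool" where *: "\<forall>n f.
    (\<Sum>i<n. of_bool (y i) + real t * of_bool (f i) * (1 - of_bool (y i)))
      \<le> (\<Sum>i<n. \<alpha> * of_bool (f i) + \<beta> * (of_bool (f i) * (1 - of_bool True))
              + \<gamma> * ((1 - of_bool (f i)) * of_bool True)) + \<kappa>"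
    by (rule asg_competitive_const_prediction[OF assms, where b = True], erule that)
  \<comment> \<open>The smaller of the two excesses of cost over bound: \<open>t - \<alpha>\<close>
    after answer 0, \<open>1 - \<gamma>\<close> after answer 1.\<close>
  let ?m = "min (real t - \<alpha>) (1 - \<gamma>)"
  have "?m * real n \<le> \<kappa>" for n
  proof -
    have "(\<Sum>i<n. ?m + (\<alpha> * of_bool (\<not> y i) + \<gamma> * (1 - of_bool (\<not> y i))))
        \<le> (\<Sum>i<n. of_bool (y i) + real t * of_bool (\<not> y i) * (1 - of_bool (y i)))"
      by (intro sum_mono) auto
    moreover have "(\<Sum>i<n. of_bool (y i) + real t * of_bool (\<not> y i) * (1 - of_bool (y i)))
        \<le> (\<Sum>i<n. \<alpha> * of_bool (\<not> y i) + \<gamma> * (1 - of_bool (\<not> y i))) + \<kappa>"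
      using *[rule_format, of "\<lambda>i. \<not> y i" n] by simp
    ultimately show ?thesis
      by (simp add: sum.distrib mult.commute)
  qed
  then have "?m \<le> 0"
    by (rule linear_bounded_imp_nonpos)
  then show ?thesis
    by linarith
qed

lemma asg_competitive_always_zero:
  assumes "real t \<le> \<alpha>" "0 \<le> \<beta>" "0 \<le> \<gamma>"
  shows "asg_competitive t mu0 mu1 \<alpha> \<beta> \<gamma> (\<lambda>_. False)"
proof -
  have "asg_cost t (\<lambda>_. False) I \<le> \<alpha> * asg_opt I + \<beta> * mu0 I + \<gamma> * mu1 I + 0" for I
  proof (cases I)
    case (fields x xh r)
    have "asg_cost t (\<lambda>_. False) I \<le> (\<Sum>i<length x. \<alpha> * of_bool (x ! i)
        + \<beta> * (of_bool (x ! i) * (1 - of_bool (xh ! i)))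
        + \<gamma> * ((1 - of_bool (x ! i)) * of_bool (xh ! i)))"
      unfolding fields asg_cost.simps using assms
      by (intro sum_mono) (auto simp: asg_output_def)
    then show ?thesis
      by (simp only: fields asg_bound_eq_sum add_0_right)
  qed
  then show ?thesis
    using assms unfolding asg_competitive_def by (meson of_nat_0_le_iff order_trans)
qed

text \<open>Compared round by round: a correct 1 costs 1 against \<open>\<alpha>\<close>, a missed 1
  costs \<open>t\<close> against \<open>\<alpha> + \<beta>\<close>, a false 1 costs 1 against
  \<open>\<gamma>\<close>.\<close>

lemma asg_competitive_follow_prediction:
  assumes "1 \<le> \<alpha>" "0 \<le> \<beta>" "1 \<le> \<gamma>" "real t \<le> \<alpha> + \<beta>"
  shows "asg_competitive t mu0 mu1 \<alpha> \<beta> \<gamma> (\<lambda>h. snd (last h))"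
proof -
  let ?A = "\<lambda>h :: (request \<times> bool) list. snd (last h)"
  have "asg_cost t ?A I \<le> \<alpha> * asg_opt I + \<beta> * mu0 I + \<gamma> * mu1 I + 0"
    if "I \<in> asg_instances" for I
  proof (cases I)
    case (fields x xh r)
    have "asg_output ?A xh r i = xh ! i" if "i < length x" for i
      using that \<open>I \<in> asg_instances\<close>
      by (simp add: fields asg_instances_def asg_output_def take_Suc_conv_app_nth)
    then have "asg_cost t ?A I \<le> (\<Sum>i<length x. \<alpha> * of_bool (x ! i)
        + \<beta> * (of_bool (x ! i) * (1 - of_bool (xh ! i)))
        + \<gamma> * ((1 - of_bool (x ! i)) * of_bool (xh ! i)))"
      unfolding fields asg_cost.simps using assms
      by (intro sum_mono) auto
    then show ?thesis
      by (simp only: fields asg_bound_eq_sum add_0_right)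
  qed
  then show ?thesis
    using assms unfolding asg_competitive_def by (meson zero_le_one order_trans)
qed

lemma ex_asg_competitive_iff:
  assumes "t > 0"
  shows "(\<exists>A. asg_competitive t mu0 mu1 \<alpha> \<beta> \<gamma> A) \<longleftrightarrow>
    1 \<le> \<alpha> \<and> 0 \<le> \<beta> \<and> 0 \<le> \<gamma> \<and> real t \<le> \<alpha> + \<beta> \<and> (real t \<le> \<alpha> \<or> 1 \<le> \<gamma>)"
    (is "?L \<longleftrightarrow> ?R")
proof
  assume ?L
  then obtain A where A: "asg_competitive t mu0 mu1 \<alpha> \<beta> \<gamma> A" ..
  then have "0 \<le> \<beta>" "0 \<le> \<gamma>"
    by (simp_all add: asg_competitive_def)
  with A show ?R
    using assms asg_competitive_opt_coeff_ge_1 asg_competitive_sum_ge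
      asg_competitive_opt_coeff_ge_or_mu1_coeff_ge by blast
next
  assume ?R
  then show ?L
    using asg_competitive_always_zero asg_competitive_follow_prediction by blast
qed

theorem theorem13:
  fixes t :: nat and \<alpha> \<beta> \<gamma> :: real and A :: asg_algorithm
  assumes "t > 0"
    and "asg_competitive t mu0 mu1 \<alpha> \<beta> \<gamma> A"
  shows "asg_pareto_optimal t mu0 mu1 \<alpha> \<beta> \<gamma> A \<longleftrightarrow>
    (\<alpha> = real t \<and> \<beta> = 0 \<and> \<gamma> = 0) \<or>
    (\<alpha> < real t \<and> \<beta> = real t - \<alpha> \<and> \<gamma> = 1)"
    (is "?P \<longleftrightarrow> ?R")
proof
  have t: "1 \<le> real t"
    using assms(1) by linarith
  have region: "1 \<le> \<alpha>" "0 \<le> \<beta>" "0 \<le> \<gamma>" "real t \<le> \<alpha> + \<beta>" "real t \<le> \<alpha> \<or> 1 \<le> \<gamma>"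
    using assms ex_asg_competitive_iff by blast+
  assume ?P
  then have no_better: "\<forall>\<epsilon>>0. \<not> (\<exists>B. asg_competitive t mu0 mu1 (\<alpha> - \<epsilon>) \<beta> \<gamma> B)"
      "\<forall>\<epsilon>>0. \<not> (\<exists>B. asg_competitive t mu0 mu1 \<alpha> (\<beta> - \<epsilon>) \<gamma> B)"
      "\<forall>\<epsilon>>0. \<not> (\<exists>B. asg_competitive t mu0 mu1 \<alpha> \<beta> (\<gamma> - \<epsilon>) B)"
    unfolding asg_pareto_optimal_def by blast+
  note no_better = no_better[unfolded ex_asg_competitive_iff[OF assms(1)], THEN spec]
  show ?R
  proof (cases "real t \<le> \<alpha>")
    case True
    \<comment> \<open>Each \<epsilon> lowers one coordinate exactly to the boundary of the
      attainable region: \<open>\<alpha>\<close> to \<open>t\<close>, \<open>\<beta>\<close> to 0,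
      \<open>\<gamma>\<close> to 0.\<close>
    then have "\<not> \<alpha> > real t" "\<not> \<beta> > 0" "\<not> \<gamma> > 0"
      using no_better(1)[of "\<alpha> - real t"] no_better(2)[of \<beta>] no_better(3)[of \<gamma>] region t
      by auto
    with True region show ?thesis
      by linarith
  next
    case False
    \<comment> \<open>Here the boundary values are \<open>t - \<alpha>\<close> for
      \<open>\<beta>\<close> and 1 for \<open>\<gamma>\<close>.\<close>
    then have "\<not> \<beta> > real t - \<alpha>" "\<not> \<gamma> > 1"
      using no_better(2)[of "\<beta> - (real t - \<alpha>)"] no_better(3)[of "\<gamma> - 1"] region
      by auto
    with False region show ?thesis
      by linarith
  qed
next
  assume ?R
  \<comment> \<open>In both cases \<open>\<alpha> + \<beta> = t\<close>, so neither summand can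
    shrink; lowering \<open>\<gamma>\<close> makes it negative in the first case and in the second
    drops it below 1 while \<open>\<alpha> < t\<close>.\<close>
  then show ?P
    using assms(2) unfolding asg_pareto_optimal_def ex_asg_competitive_iff[OF assms(1)]
    by auto
qed

end
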